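(* Let $G$ be a compact metrizable topological group. Then there exists a compact metric space $K$ such that $G$ is isomorphic, as a topological group, to the isometry group $\mathrm{Iso}(K)$.
   Context: For a metric space $K$, $\mathrm{Iso}(K)$ denotes the group of all isometries of $K$ onto itself under composition, endowed with the topology of pointwise convergence (the topology induced by the product topology on $K^K$). An isomorphism of topological groups is a group isomorphism that is also a homeomorphism. *)

theory Defs
  imports "HOL-Analysis.Analysis" "HOL-Algebra.Bij"
begin

locale topological_group = group G for G :: "('a, 'b) monoid_scheme" (structure) +
  fixes T :: "'a topology"
  assumes topspace_eq_carrier: "topspace T = carrier G"
    and continuous_mult: "continuous_map (prod_topology T T) T (\<lambda>(x, y). x \<otimes> y)"
    and continuous_inv: "continuous_map T T (\<lambda>x. inv x)"

text \<open>Following \<^const>\<open>Bij\<close>, self-maps of a carrier set are taken to be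
  extensional (\<^const>\<open>undefined\<close> outside the set), so that an isometry is determined by its
  values on the space.\<close>

definition isometries :: "'k metric \<Rightarrow> ('k \<Rightarrow> 'k) set" where
  "isometries K = {f \<in> Bij (mspace K).
     \<forall>x \<in> mspace K. \<forall>y \<in> mspace K. mdist K (f x) (f y) = mdist K x y}"

definition Iso_group :: "'k metric \<Rightarrow> ('k \<Rightarrow> 'k) monoid" where
  "Iso_group K = BijGroup (mspace K) \<lparr>carrier := isometries K\<rparr>"

definition Iso_topology :: "'k metric \<Rightarrow> ('k \<Rightarrow> 'k) topology" where
  "Iso_topology K =
     subtopology (product_topology (\<lambda>_. mtopology_of K) (mspace K)) (isometries K)"

definition topological_group_isomorphic ::
  "('a, 'c) monoid_scheme \<Rightarrow> 'a topology \<Rightarrow> ('b, 'd) monoid_scheme \<Rightarrow> 'b topology \<Rightarrow> bool" where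
  "topological_group_isomorphic G T H S \<longleftrightarrow> (\<exists>h. h \<in> iso G H \<and> homeomorphic_map T S h)"

lemma topspace_Iso_topology: "topspace (Iso_topology K) = carrier (Iso_group K)"
  by (auto simp: Iso_topology_def Iso_group_def isometries_def Bij_def bij_betw_def PiE_def)

lemma mult_Iso_group:
  assumes "f \<in> carrier (Iso_group K)" "g \<in> carrier (Iso_group K)"
  shows "f \<otimes>\<^bsub>Iso_group K\<^esub> g = compose (mspace K) f g"
  using assms by (simp add: Iso_group_def isometries_def BijGroup_def)

lemma subgroup_isometries: "subgroup (isometries K) (BijGroup (mspace K))"
proof -
  let ?M = "mspace K"
  interpret B: group "BijGroup ?M" by (rule group_BijGroup)
  have map: "f x \<in> ?M" if "f \<in> Bij ?M" "x \<in> ?M" for f x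
    using that by (auto simp: Bij_def bij_betw_def)
  show ?thesis
  proof (rule B.subgroupI)
    show "isometries K \<subseteq> carrier (BijGroup ?M)"
      by (auto simp: isometries_def BijGroup_def)
    have "(\<lambda>x\<in>?M. x) \<in> isometries K"
      by (auto simp: isometries_def id_Bij)
    then show "isometries K \<noteq> {}" by blast
  next
    fix f assume f: "f \<in> isometries K"
    then have fB: "f \<in> Bij ?M" by (simp add: isometries_def)
    let ?g = "inv_into ?M f"
    have g: "?g y \<in> ?M" "f (?g y) = y" if "y \<in> ?M" for y
      using fB that by (auto simp: Bij_def bij_betw_def inv_into_into f_inv_into_f)
    have "mdist K (?g x) (?g y) = mdist K x y" if "x \<in> ?M" "y \<in> ?M" for x y
    proof -
      have "mdist K (f (?g x)) (f (?g y)) = mdist K (?g x) (?g y)"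
        using f g(1)[OF that(1)] g(1)[OF that(2)] by (simp add: isometries_def)
      then show ?thesis using g that by simp
    qed
    then show "inv\<^bsub>BijGroup ?M\<^esub> f \<in> isometries K"
      using fB restrict_inv_into_Bij[OF fB] by (simp add: inv_BijGroup isometries_def)
  next
    fix f g assume "f \<in> isometries K" "g \<in> isometries K"
    then show "f \<otimes>\<^bsub>BijGroup ?M\<^esub> g \<in> isometries K"
      using map by (auto simp: isometries_def BijGroup_def compose_Bij compose_eq)
  qed
qed

lemma group_Iso_group: "group (Iso_group K)"
  unfolding Iso_group_def
  by (rule subgroup.subgroup_is_group[OF subgroup_isometries group_BijGroup])

text \<open>Every compact metric space is isometric to one whose points are real sequences (send a
  point to its distances from a countable dense set). Hence quantifying existentially over
  metrics of type \<^typ>\<open>(nat \<Rightarrow> real) metric\<close> amounts to quantifying over all compact metric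
  spaces.\<close>

lemma compact_metric_on_sequences:
  fixes K :: "'k metric"
  assumes "compact_space (mtopology_of K)"
  shows "\<exists>(K' :: (nat \<Rightarrow> real) metric) \<phi>.
    bij_betw \<phi> (mspace K) (mspace K') \<and>
    (\<forall>x \<in> mspace K. \<forall>y \<in> mspace K. mdist K' (\<phi> x) (\<phi> y) = mdist K x y) \<and>
    compact_space (mtopology_of K')"
proof -
  let ?M = "mspace K" and ?d = "mdist K"
  interpret M: Metric_space ?M ?d by simp
  have "compactin M.mtopology ?M"
    using assms by (simp add: compact_space_def mtopology_of_def)
  then have tb: "M.mtotally_bounded ?M"
    using M.compactin_imp_mtotally_bounded by blast
  have "\<exists>F. finite F \<and> F \<subseteq> ?M \<and> ?M \<subseteq> (\<Union>x\<in>F. M.mball x (1 / Suc n))" for n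
    using tb unfolding M.mtotally_bounded_def by simp
  then obtain F where F: "\<And>n. finite (F n)" "\<And>n. F n \<subseteq> ?M"
      "\<And>n. ?M \<subseteq> (\<Union>x\<in>F n. M.mball x (1 / Suc n))"
    by metis
  define D where "D = (\<Union>n. F n)"
  have cD: "countable D" unfolding D_def using F(1) by (simp add: countable_finite)
  have dense: "\<exists>z\<in>D. ?d z x < e" if "x \<in> ?M" "e > 0" for x e
  proof -
    obtain n where n: "1 / Suc n < e"
      using nat_approx_posE[OF \<open>e > 0\<close>] by blast
    obtain z where "z \<in> F n" "x \<in> M.mball z (1 / Suc n)"
      using F(3) \<open>x \<in> ?M\<close> by blast
    then show ?thesis
      using n unfolding D_def by (intro bexI[of _ z]) auto
  qed
  define \<phi> :: "'k \<Rightarrow> nat \<Rightarrow> real" where "\<phi> = (\<lambda>x n. ?d (from_nat_into D n) x)"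
  have inj: "inj_on \<phi> ?M"
  proof (rule inj_onI, rule ccontr)
    fix x y assume xy: "x \<in> ?M" "y \<in> ?M" "\<phi> x = \<phi> y" "x \<noteq> y"
    then have "?d x y / 2 > 0" by simp
    then obtain z where z: "z \<in> D" "?d z x < ?d x y / 2"
      using dense xy(1) by blast
    have "z \<in> ?M" using z(1) F(2) by (auto simp: D_def)
    obtain n where "from_nat_into D n = z"
      using from_nat_into_surj[OF cD z(1)] by blast
    with fun_cong[OF xy(3), of n] have "?d z x = ?d z y"
      by (simp add: \<phi>_def)
    moreover have "?d x y \<le> ?d x z + ?d z y"
      using M.triangle xy \<open>z \<in> ?M\<close> by blast
    ultimately show False using z(2) M.commute[of x z] by linarith
  qed
  let ?N = "\<phi> ` ?M"
  let ?g = "inv_into ?M \<phi>"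
  let ?e = "\<lambda>u v. ?d (?g u) (?g v)"
  have gN: "?g u \<in> ?M" if "u \<in> ?N" for u using that by (rule inv_into_into)
  have geq: "?g u = ?g v \<longleftrightarrow> u = v" if "u \<in> ?N" "v \<in> ?N" for u v
    using that by (metis f_inv_into_f)
  interpret N: Metric_space ?N ?e
  proof
    show "?e u v = 0 \<longleftrightarrow> u = v" if "u \<in> ?N" "v \<in> ?N" for u v
      using M.zero[OF gN[OF that(1)] gN[OF that(2)]] geq[OF that] by blast
    show "?e u w \<le> ?e u v + ?e v w" if "u \<in> ?N" "v \<in> ?N" "w \<in> ?N" for u v w
      using M.triangle[OF gN[OF that(1)] gN[OF that(2)] gN[OF that(3)]] .
  qed (auto simp: M.commute)
  have iso: "?e (\<phi> x) (\<phi> y) = ?d x y" if "x \<in> ?M" "y \<in> ?M" for x y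
    using inj that by (simp add: inv_into_f_f)
  interpret MN: Metric_space12 ?M ?d ?N ?e ..
  have "homeomorphic_map M.mtopology N.mtopology \<phi>"
    by (rule MN.isometry_imp_homeomorphic_map) (auto simp: iso)
  then have "compact_space N.mtopology"
    using assms homeomorphic_compact_space homeomorphic_map_imp_homeomorphic_space
    by (metis mtopology_of_def)
  then show ?thesis
    using inj iso
    by (intro exI[of _ N.Self] exI[of _ \<phi>]) (auto simp: bij_betw_def mtopology_of_def)
qed

end

theory Submission
  imports Defs
begin

text \<open>\<open>G\<close> carries a bi-invariant metric \<open>d \<le> 1\<close>. Its left translations are exactly the maps that
  commute with the right translations by the members of a dense sequence \<open>a\<close>, so it suffices to
  encode these right translations in a compact metric space on which \<open>G\<close> still acts. Take a copy of
  \<open>G\<close> scaled by \<open>1 / n\<close> at each level \<open>n \<ge> 2\<close>, shrinking to a limit point, and put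
  \<open>(x, i)\<close> and \<open>(y, j)\<close>, \<open>i < j\<close>, at distance \<open>1 / i + d (x a\<^sub>j) y / j\<close>. One additional
  marker point, whose distance to the others determines their level, forces every isometry to
  preserve levels. Comparing distances across levels, an isometry acts by the same map on
  all copies of \<open>G\<close>, and that map commutes with each right translation by \<open>a\<^sub>j\<close>.\<close>

section \<open>Bi-invariant metrics on compact groups\<close>

text \<open>Take the supremum of a truncated compatible metric over all two-sided translates of a
  pair: a further translation only re-indexes the supremum, and compactness of
  \<open>G \<times> G\<close> keeps the topology.\<close>

lemma (in topological_group) ex_bi_invariant_metric:
  assumes cpt: "compact_space T" and "metrizable_space T"
  obtains d where "Metric_space (carrier G) d" "Metric_space.mtopology (carrier G) d = T"
    "\<And>x y. d x y \<le> 1"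
    "\<And>g x y. g \<in> carrier G \<Longrightarrow> x \<in> carrier G \<Longrightarrow> y \<in> carrier G \<Longrightarrow> d (g \<otimes> x) (g \<otimes> y) = d x y"
    "\<And>g x y. g \<in> carrier G \<Longrightarrow> x \<in> carrier G \<Longrightarrow> y \<in> carrier G \<Longrightarrow> d (x \<otimes> g) (y \<otimes> g) = d x y"
proof -
  let ?S = "carrier G"
  obtain M d0 where M: "Metric_space M d0" and T: "T = Metric_space.mtopology M d0"
    using \<open>metrizable_space T\<close> by (auto simp: metrizable_space_def)
  interpret M: Metric_space M d0 by fact
  have MS: "M = ?S" using topspace_eq_carrier T by simp
  \<comment> \<open>Truncation bounds the supremum and yields \<open>d \<le> 1\<close> for all
    arguments, even outside the carrier.\<close>
  define c where "c x y = min 1 (d0 x y)" for x y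
  have c: "0 \<le> c x y" "c x y \<le> 1" "c x y = c y x" for x y
    by (auto simp: c_def M.commute)
  define d where "d x y = (SUP (a, b) \<in> ?S \<times> ?S. c (a \<otimes> x \<otimes> b) (a \<otimes> y \<otimes> b))" for x y
  have le_d: "c (a \<otimes> x \<otimes> b) (a \<otimes> y \<otimes> b) \<le> d x y" if "a \<in> ?S" "b \<in> ?S" for a b x y
    unfolding d_def using that c(2) by (intro cSUP_upper2[of _ _ "(a, b)"] bdd_aboveI2[where M = 1]) auto
  have d_le: "d x y \<le> e"
    if "\<And>a b. a \<in> ?S \<Longrightarrow> b \<in> ?S \<Longrightarrow> c (a \<otimes> x \<otimes> b) (a \<otimes> y \<otimes> b) \<le> e" for x y e
    unfolding d_def using that by (intro cSUP_least) auto
  have c_le_d: "c x y \<le> d x y" if "x \<in> ?S" "y \<in> ?S" for x y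
    using le_d[of \<one> \<one> x y] that by simp
  have Md: "Metric_space ?S d"
  proof
    show "0 \<le> d x y" for x y
      using le_d[of \<one> \<one> x y] c(1) order_trans by blast
    show "d x y = d y x" for x y
      unfolding d_def using c(3) by (metis (no_types, lifting))
    show "d x y = 0 \<longleftrightarrow> x = y" if "x \<in> ?S" "y \<in> ?S" for x y
    proof
      assume "d x y = 0"
      then have "c x y = 0" using c_le_d[OF that] c(1)[of x y] by simp
      then show "x = y" using that MS M.zero by (auto simp: c_def min_def split: if_splits)
    next
      assume "x = y"
      have "d x x \<le> 0" using that MS by (intro d_le) (auto simp: c_def)
      then show "d x y = 0" using \<open>x = y\<close> \<open>0 \<le> d x y\<close> by simp
    qed
    show "d x z \<le> d x y + d y z" if "x \<in> ?S" "y \<in> ?S" "z \<in> ?S" for x y z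
    proof (rule d_le)
      fix a b assume ab: "a \<in> ?S" "b \<in> ?S"
      have "d0 (a \<otimes> x \<otimes> b) (a \<otimes> z \<otimes> b) \<le> d0 (a \<otimes> x \<otimes> b) (a \<otimes> y \<otimes> b) + d0 (a \<otimes> y \<otimes> b) (a \<otimes> z \<otimes> b)"
        using that ab MS by (intro M.triangle) auto
      then have "c (a \<otimes> x \<otimes> b) (a \<otimes> z \<otimes> b) \<le> c (a \<otimes> x \<otimes> b) (a \<otimes> y \<otimes> b) + c (a \<otimes> y \<otimes> b) (a \<otimes> z \<otimes> b)"
        using M.nonneg[of "a \<otimes> x \<otimes> b" "a \<otimes> y \<otimes> b"] M.nonneg[of "a \<otimes> y \<otimes> b" "a \<otimes> z \<otimes> b"]
        unfolding c_def by linarith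
      then show "c (a \<otimes> x \<otimes> b) (a \<otimes> z \<otimes> b) \<le> d x y + d y z"
        using le_d[OF ab, of x y] le_d[OF ab, of y z] by linarith
    qed
  qed
  interpret D: Metric_space ?S d by fact
  \<comment> \<open>One direction is enough: a continuous bijection from a compact space onto a
    Hausdorff space is a homeomorphism.\<close>
  have "continuous_map T D.mtopology id"
    unfolding D.continuous_map_to_metric
  proof (intro ballI allI impI)
    fix x and e :: real assume "x \<in> topspace T" "e > 0"
    then have x: "x \<in> ?S" using topspace_eq_carrier by simp
    let ?P = "prod_topology (prod_topology T T) T"
    have mult: "continuous_map ?P T (\<lambda>p. f p \<otimes> g p)"
      if "continuous_map ?P T f" "continuous_map ?P T g" for f g
      using continuous_map_compose[OF continuous_map_pairedI[OF that] continuous_mult]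
      by (simp add: comp_def)
    let ?u = "\<lambda>p. fst (fst p) \<otimes> x \<otimes> snd (fst p)" and ?v = "\<lambda>p. fst (fst p) \<otimes> snd p \<otimes> snd (fst p)"
    have fst: "continuous_map ?P T (\<lambda>p. fst (fst p))"
      using continuous_map_compose[OF continuous_map_fst continuous_map_fst] by (simp add: comp_def)
    have snd: "continuous_map ?P T (\<lambda>p. snd (fst p))"
      using continuous_map_compose[OF continuous_map_fst continuous_map_snd] by (simp add: comp_def)
    have "continuous_map ?P T ?u" "continuous_map ?P T ?v"
      using x topspace_eq_carrier by (intro mult fst snd continuous_map_snd; simp)+
    then have "continuous_map ?P euclideanreal (\<lambda>p. d0 (?u p) (?v p))"
      using continuous_map_mdist[of ?P M.Self ?u ?v] by (simp add: T mtopology_of_def)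
    then have W: "openin ?P {p \<in> topspace ?P. d0 (?u p) (?v p) \<in> {..<e / 2}}"
      by (rule openin_continuous_map_preimage) auto
    have cpt2: "compactin (prod_topology T T) (?S \<times> ?S)"
      using cpt topspace_eq_carrier by (simp add: compactin_Times compact_space_def)
    have tube: "(?S \<times> ?S) \<times> {x} \<subseteq> {p \<in> topspace ?P. d0 (?u p) (?v p) \<in> {..<e / 2}}"
      using x topspace_eq_carrier \<open>e > 0\<close> MS by auto
    \<comment> \<open>The tube lemma gives one neighbourhood \<open>V\<close> of \<open>x\<close>
      that serves all pairs \<open>(a, b)\<close> at once. The bound \<open>e / 2\<close> leaves
      room, since a supremum of values below it may equal it.\<close>
    obtain U V where UV: "?S \<times> ?S \<subseteq> U" "openin T V" "x \<in> V"
      "U \<times> V \<subseteq> {p \<in> topspace ?P. d0 (?u p) (?v p) \<in> {..<e / 2}}"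
      using tube_lemma_left[OF W cpt2 \<open>x \<in> topspace T\<close> tube] by blast
    have "id y \<in> D.mball (id x) e" if "y \<in> V" for y
    proof -
      have y: "y \<in> ?S" using UV(2) that topspace_eq_carrier openin_subset by blast
      have "d x y \<le> e / 2"
      proof (rule d_le)
        fix a b assume "a \<in> ?S" "b \<in> ?S"
        then have "((a, b), y) \<in> U \<times> V" using UV(1) that by blast
        then show "c (a \<otimes> x \<otimes> b) (a \<otimes> y \<otimes> b) \<le> e / 2"
          using UV(4) by (force simp: c_def)
      qed
      then show ?thesis using x y \<open>e > 0\<close> by simp
    qed
    then show "\<exists>U. openin T U \<and> x \<in> U \<and> (\<forall>y\<in>U. id y \<in> D.mball (id x) e)"
      using UV by blast
  qed
  then have "homeomorphic_map T D.mtopology id"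
    using cpt topspace_eq_carrier D.Hausdorff_space_mtopology
    by (intro continuous_imp_homeomorphic_map) auto
  then have top: "D.mtopology = T" by simp
  have left: "d (g \<otimes> x) (g \<otimes> y) \<le> d x y" if "g \<in> ?S" "x \<in> ?S" "y \<in> ?S" for g x y
  proof (rule d_le)
    fix a b assume "a \<in> ?S" "b \<in> ?S"
    then show "c (a \<otimes> (g \<otimes> x) \<otimes> b) (a \<otimes> (g \<otimes> y) \<otimes> b) \<le> d x y"
      using that le_d[of "a \<otimes> g" b x y] by (simp add: m_assoc)
  qed
  have right: "d (x \<otimes> g) (y \<otimes> g) \<le> d x y" if "g \<in> ?S" "x \<in> ?S" "y \<in> ?S" for g x y
  proof (rule d_le)
    fix a b assume "a \<in> ?S" "b \<in> ?S"
    then show "c (a \<otimes> (x \<otimes> g) \<otimes> b) (a \<otimes> (y \<otimes> g) \<otimes> b) \<le> d x y"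
      using that le_d[of a "g \<otimes> b" x y] by (simp add: m_assoc)
  qed
  show thesis
  proof (rule that[OF Md top])
    show "d x y \<le> 1" for x y by (intro d_le c(2))
    \<comment> \<open>The reverse inequalities come from translating back by
      \<open>inv g\<close>.\<close>
    fix g x y assume *: "g \<in> ?S" "x \<in> ?S" "y \<in> ?S"
    have "inv g \<otimes> (g \<otimes> x) = x" "inv g \<otimes> (g \<otimes> y) = y"
      using * by (simp_all flip: m_assoc)
    then show "d (g \<otimes> x) (g \<otimes> y) = d x y"
      using left[OF *] left[of "inv g" "g \<otimes> x" "g \<otimes> y"] * by simp
    show "d (x \<otimes> g) (y \<otimes> g) = d x y"
      using right[OF *] right[of "inv g" "x \<otimes> g" "y \<otimes> g"] * by (simp add: m_assoc)
  qed
qed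

section \<open>Actions that exhaust the isometry group\<close>

text \<open>Pointwise continuity of the action is continuity into the product topology; as
  \<open>T\<close> is compact and the target Hausdorff, the inverse is continuous too.\<close>

lemma topological_group_isomorphic_IsoI:
  fixes G :: "('a, 'b) monoid_scheme" and K :: "'k metric" and act :: "'a \<Rightarrow> 'k \<Rightarrow> 'k"
  assumes "topological_group G T" "compact_space T"
    and closed: "\<And>g x. g \<in> carrier G \<Longrightarrow> x \<in> mspace K \<Longrightarrow> act g x \<in> mspace K"
    and mult: "\<And>g h x. g \<in> carrier G \<Longrightarrow> h \<in> carrier G \<Longrightarrow> x \<in> mspace K \<Longrightarrow>
      act (g \<otimes>\<^bsub>G\<^esub> h) x = act g (act h x)"
    and isometric: "\<And>g x y. g \<in> carrier G \<Longrightarrow> x \<in> mspace K \<Longrightarrow> y \<in> mspace K \<Longrightarrow>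
      mdist K (act g x) (act g y) = mdist K x y"
    and cont: "\<And>x. x \<in> mspace K \<Longrightarrow> continuous_map T (mtopology_of K) (\<lambda>g. act g x)"
    and faithful: "\<And>g h. g \<in> carrier G \<Longrightarrow> h \<in> carrier G \<Longrightarrow>
      (\<And>x. x \<in> mspace K \<Longrightarrow> act g x = act h x) \<Longrightarrow> g = h"
    and full: "\<And>\<psi>. \<psi> \<in> isometries K \<Longrightarrow> \<exists>g \<in> carrier G. \<forall>x \<in> mspace K. \<psi> x = act g x"
  shows "topological_group_isomorphic G T (Iso_group K) (Iso_topology K)"
proof -
  interpret topological_group G T by fact
  let ?M = "mspace K"
  define h where "h g = restrict (act g) ?M" for g
  have inj: "x = y" if "g \<in> carrier G" "x \<in> ?M" "y \<in> ?M" "act g x = act g y" for g x y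
  proof -
    have "mdist K x y = mdist K (act g y) (act g y)"
      using isometric[OF that(1-3)] that(4) by simp
    also have "\<dots> = 0" using closed that by simp
    finally show ?thesis using that by simp
  qed
  \<comment> \<open>The map \<open>act \<one>\<close> is idempotent, and it is injective because it
    preserves distances.\<close>
  have one: "act \<one>\<^bsub>G\<^esub> x = x" if "x \<in> ?M" for x
  proof (rule inj[of "\<one>\<^bsub>G\<^esub>"])
    show "act \<one>\<^bsub>G\<^esub> (act \<one>\<^bsub>G\<^esub> x) = act \<one>\<^bsub>G\<^esub> x"
      using mult[of "\<one>\<^bsub>G\<^esub>" "\<one>\<^bsub>G\<^esub>" x, symmetric] that by simp
  qed (use that closed in auto)
  have h: "h g \<in> isometries K" if g: "g \<in> carrier G" for g
  proof -
    have "bij_betw (act g) ?M ?M"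
    proof (rule bij_betw_byWitness[where f' = "act (inv\<^bsub>G\<^esub> g)"])
      show "\<forall>x\<in>?M. act (inv\<^bsub>G\<^esub> g) (act g x) = x" "\<forall>x\<in>?M. act g (act (inv\<^bsub>G\<^esub> g) x) = x"
        using g one by (simp_all flip: mult)
    qed (use g closed in auto)
    then show ?thesis
      using g isometric by (simp add: h_def isometries_def Bij_def bij_betw_restrict_eq)
  qed
  have inj_h: "inj_on h (carrier G)"
  proof (rule inj_onI, rule faithful)
    show "act g x = act g' x" if "h g = h g'" "x \<in> ?M" for g g' x
      using fun_cong[OF that(1), of x] that(2) by (simp add: h_def)
  qed auto
  have "isometries K \<subseteq> h ` carrier G"
  proof
    fix \<psi> assume \<psi>: "\<psi> \<in> isometries K"
    then obtain g where g: "g \<in> carrier G" "\<forall>x \<in> ?M. \<psi> x = act g x"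
      using full by blast
    \<comment> \<open>Agreement on the space gives equality of functions because both sides are
      extensional.\<close>
    have "\<psi> = restrict \<psi> ?M"
      using \<psi> by (simp add: isometries_def Bij_def extensional_restrict)
    also have "\<dots> = h g" unfolding h_def using g(2) by (intro restrict_ext) simp
    finally show "\<psi> \<in> h ` carrier G" using g(1) by blast
  qed
  with h have surj: "h ` carrier G = isometries K" by blast
  have carrier: "carrier (Iso_group K) = isometries K" by (simp add: Iso_group_def)
  have "h \<in> hom G (Iso_group K)"
  proof (rule homI)
    show "h (x \<otimes>\<^bsub>G\<^esub> y) = h x \<otimes>\<^bsub>Iso_group K\<^esub> h y" if "x \<in> carrier G" "y \<in> carrier G" for x y
      using that h closed by (auto simp: mult_Iso_group carrier h_def mult compose_def)
  qed (simp add: h carrier)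
  with inj_h surj have "h \<in> iso G (Iso_group K)"
    by (simp add: iso_def bij_betw_def carrier)
  moreover have "homeomorphic_map T (Iso_topology K) h"
  proof (rule continuous_imp_homeomorphic_map)
    show "continuous_map T (Iso_topology K) h"
      unfolding Iso_topology_def
    proof (intro continuous_map_into_subtopology)
      show "continuous_map T (product_topology (\<lambda>_. mtopology_of K) ?M) h"
        unfolding continuous_map_componentwise using cont by (auto simp: h_def)
      show "h \<in> topspace T \<rightarrow> isometries K"
        using h topspace_eq_carrier by auto
    qed
    have "Hausdorff_space (mtopology_of K)"
      by (simp add: Metric_space.Hausdorff_space_mtopology mtopology_of_def)
    then show "Hausdorff_space (Iso_topology K)"
      unfolding Iso_topology_def
      by (intro Hausdorff_space_subtopology) (simp add: Hausdorff_space_product_topology)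
  qed (simp_all add: \<open>compact_space T\<close> topspace_Iso_topology surj inj_h carrier topspace_eq_carrier)
  ultimately show ?thesis
    unfolding topological_group_isomorphic_def by blast
qed

text \<open>The union of finite \<open>1 / Suc n\<close>-nets is countable and dense; being
  nonempty, it is the range of a sequence.\<close>

lemma (in Metric_space) compact_imp_dense_sequence:
  assumes "compact_space mtopology" "M \<noteq> {}"
  obtains a :: "nat \<Rightarrow> 'a" where "range a \<subseteq> M" "\<And>x e. x \<in> M \<Longrightarrow> 0 < e \<Longrightarrow> \<exists>n. d (a n) x < e"
proof -
  have "mtotally_bounded M"
    using assms(1) compact_space_eq_mcomplete_mtotally_bounded by blast
  then have "\<forall>n. \<exists>F. finite F \<and> F \<subseteq> M \<and> M \<subseteq> (\<Union>x\<in>F. mball x (1 / Suc n))"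
    unfolding mtotally_bounded_def by simp
  then obtain F where F: "\<And>n. finite (F n)" "\<And>n. F n \<subseteq> M"
      "\<And>n. M \<subseteq> (\<Union>x\<in>F n. mball x (1 / Suc n))"
    by metis
  define C where "C = (\<Union>n. F n)"
  have "countable C" unfolding C_def using F(1) by (simp add: countable_finite)
  moreover have "C \<noteq> {}" using F(3)[of 0] assms(2) by (auto simp: C_def)
  ultimately have C: "range (from_nat_into C) = C" by simp
  show thesis
  proof (rule that[of "from_nat_into C"])
    show "range (from_nat_into C) \<subseteq> M" unfolding C using F(2) by (auto simp: C_def)
    fix x and e :: real assume "x \<in> M" "0 < e"
    obtain n where n: "1 / Suc n < e" using nat_approx_posE[OF \<open>0 < e\<close>] by blast
    obtain z where z: "z \<in> F n" "x \<in> mball z (1 / Suc n)" using F(3) \<open>x \<in> M\<close> by blast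
    then have "z \<in> range (from_nat_into C)" unfolding C by (auto simp: C_def)
    then obtain m where "z = from_nat_into C m" by blast
    then show "\<exists>n. d (from_nat_into C n) x < e" using z n by (intro exI[of _ m]) simp
  qed
qed

section \<open>The metric on the levels\<close>

locale marked_group = topological_group G T + Metric_space "carrier G" d
  for G :: "('a, 'b) monoid_scheme" (structure) and T d +
  fixes a :: "nat \<Rightarrow> 'a"
  assumes mtopology_eq: "mtopology = T"
    and compact_T: "compact_space T"
    and d_le_1: "\<And>x y. d x y \<le> 1"
    and d_left: "\<And>g x y. g \<in> carrier G \<Longrightarrow> x \<in> carrier G \<Longrightarrow> y \<in> carrier G \<Longrightarrow> d (g \<otimes> x) (g \<otimes> y) = d x y"
    and d_right: "\<And>g x y. g \<in> carrier G \<Longrightarrow> x \<in> carrier G \<Longrightarrow> y \<in> carrier G \<Longrightarrow> d (x \<otimes> g) (y \<otimes> g) = d x y"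
    and a_closed: "a n \<in> carrier G"
    \<comment> \<open>the entries with index at most \<open>2\<close> are not encoded between copies of \<open>G\<close>\<close>
    and a_dense: "\<And>x e. x \<in> carrier G \<Longrightarrow> 0 < e \<Longrightarrow> \<exists>n>2. d (a n) x < e"
begin

text \<open>Level \<open>0\<close> holds the limit point and level \<open>1\<close> the marker.\<close>

definition points :: "('a \<times> nat) set" where
  "points = {(\<one>, 0), (\<one>, 1)} \<union> carrier G \<times> {2..}"

text \<open>The limit point gets weight \<open>0\<close>, thanks to \<open>1 / 0 = 0\<close>; thus comparing weights reverses
  the order of the levels, except that level \<open>0\<close> counts as infinite.\<close>

definition weight :: "nat \<Rightarrow> real" where
  "weight n = 1 / real n"

text \<open>The constant for \<open>i = 1\<close> makes the distance from the marker depend on the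
  level only.\<close>

definition offset :: "nat \<Rightarrow> nat \<Rightarrow> 'a \<Rightarrow> 'a \<Rightarrow> real" where
  "offset i j x y = (if i = 1 then 1 else d (x \<otimes> a j) y)"

text \<open>The larger weight is a base distance and the smaller one scales the offset, so distances
  between different levels lie between the maximum and the sum of the two weights.\<close>

fun level_dist :: "'a \<times> nat \<Rightarrow> 'a \<times> nat \<Rightarrow> real" where
  "level_dist (x, i) (y, j) =
    (if i = j then weight i * d x y
     else if weight j < weight i then weight i + weight j * offset i j x y
     else weight j + weight i * offset j i y x)"

declare level_dist.simps [simp del]

fun translate :: "'a \<Rightarrow> 'a \<times> nat \<Rightarrow> 'a \<times> nat" where
  "translate g (x, n) = (if 2 \<le> n then g \<otimes> x else x, n)"

lemma weight_nonneg [simp]: "0 \<le> weight n"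
  by (simp add: weight_def)

lemma weight_eq_iff [simp]: "weight i = weight j \<longleftrightarrow> i = j"
  by (auto simp: weight_def)

lemma weight_eq_0_iff [simp]: "weight n = 0 \<longleftrightarrow> n = 0"
  by (simp add: weight_def)

lemma weight_not_less_0 [simp]: "\<not> weight n < 0"
  by (simp add: not_less)

lemma weight_pos_iff [simp]: "0 < weight n \<longleftrightarrow> 0 < n"
  by (simp add: weight_def)

lemma weight_0 [simp]: "weight 0 = 0" and weight_1 [simp]: "weight (Suc 0) = 1" and weight_2: "weight 2 = 1 / 2"
  by (simp_all add: weight_def)

lemma weight_le: "weight n \<le> 1 / 2" if "n \<noteq> 1"
  using that by (cases "n = 0") (auto simp: weight_def field_simps)

lemma weight_mono: "weight j < weight i" if "0 < i" "i < j"
  using that by (simp add: weight_def frac_less2)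

lemma points_closed: "x \<in> carrier G" if "(x, n) \<in> points"
  using that by (auto simp: points_def)

lemma points_level_0_1: "x = \<one>" if "(x, n) \<in> points" "n < 2"
  using that by (auto simp: points_def)

lemma marker_in_points: "(\<one>, 1) \<in> points"
  by (simp add: points_def)

lemma offset_nonneg: "0 \<le> offset i j x y"
  by (simp add: offset_def)

lemma offset_le_1: "offset i j x y \<le> 1"
  by (simp add: offset_def d_le_1)

text \<open>Right invariance of \<open>d\<close> is what makes \<open>x \<otimes> a j\<close> vary
  no faster than \<open>x\<close>.\<close>

lemma offset_Lipschitz_left:
  assumes "x \<in> carrier G" "x' \<in> carrier G" "y \<in> carrier G"
  shows "offset i j x y \<le> d x x' + offset i j x' y"
proof -
  have "d (x \<otimes> a j) y \<le> d (x \<otimes> a j) (x' \<otimes> a j) + d (x' \<otimes> a j) y"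
    using assms a_closed by (intro triangle) auto
  then show ?thesis using assms a_closed by (simp add: offset_def d_right)
qed

lemma offset_Lipschitz_right:
  assumes "x \<in> carrier G" "y \<in> carrier G" "y' \<in> carrier G"
  shows "offset i j x y \<le> d y y' + offset i j x y'"
proof -
  have "d (x \<otimes> a j) y \<le> d (x \<otimes> a j) y' + d y' y"
    using assms a_closed by (intro triangle) auto
  then show ?thesis by (simp add: offset_def commute)
qed

lemma level_dist_commute: "level_dist p q = level_dist q p"
  by (cases p; cases q) (auto simp: level_dist.simps commute)

lemma level_dist_nonneg: "0 \<le> level_dist p q"
  by (cases p; cases q) (auto simp: level_dist.simps offset_nonneg)

lemma level_dist_ge_max: "max (weight i) (weight j) \<le> level_dist (x, i) (y, j)" if "i \<noteq> j"
  using that offset_nonneg by (auto simp: level_dist.simps intro: add_increasing2)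

lemma level_dist_le_add: "level_dist (x, i) (y, j) \<le> weight i + weight j" if "i \<noteq> j"
  using that by (auto simp: level_dist.simps intro!: mult_left_le offset_le_1)

lemma level_dist_same_level: "level_dist (x, i) (y, i) = weight i * d x y"
  by (simp add: level_dist.simps)

lemma level_dist_same_level_le: "level_dist (x, i) (y, i) \<le> weight i"
  by (auto simp: level_dist.simps intro!: mult_left_le d_le_1)

text \<open>This is the triangle inequality when the middle point shares a level with an end. The
  offset is 1-Lipschitz in each argument and carries the smaller weight, which is at most
  \<open>weight i\<close>.\<close>

lemma level_dist_change_point:
  assumes G: "x \<in> carrier G" "y \<in> carrier G" "z \<in> carrier G"
  shows "level_dist (x, i) (z, k) \<le> weight i * d x y + level_dist (y, i) (z, k)"
proof -
  consider "i = k" | "i \<noteq> k" "weight k < weight i" | "i \<noteq> k" "weight i \<le> weight k"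
    by fastforce
  then show ?thesis
  proof cases
    case 1
    then show ?thesis
      using mult_left_mono[OF triangle[OF G], of "weight i"] by (simp add: level_dist.simps algebra_simps)
  next
    case 2
    have "weight k * offset i k x z \<le> weight k * (d x y + offset i k y z)"
      using offset_Lipschitz_left G by (intro mult_left_mono) auto
    also have "\<dots> \<le> weight i * d x y + weight k * offset i k y z"
      using 2 by (simp add: distrib_left mult_right_mono)
    finally show ?thesis using 2 by (simp add: level_dist.simps)
  next
    case 3
    have "weight i * offset k i z x \<le> weight i * (d x y + offset k i z y)"
      using offset_Lipschitz_right G by (intro mult_left_mono) auto
    then show ?thesis using 3 by (simp add: level_dist.simps distrib_left)
  qed
qed

sublocale K: Metric_space points level_dist
proof
  show "level_dist p q = 0 \<longleftrightarrow> p = q" if "p \<in> points" "q \<in> points" for p q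
  proof (cases p; cases q)
    fix x i y j assume pq: "p = (x, i)" "q = (y, j)"
    show ?thesis
    proof (cases "i = j")
      case True
      \<comment> \<open>The vanishing weight separates nothing at level \<open>0\<close>, but that
        level has a single point.\<close>
      have "x = y" if "i = 0"
        using points_level_0_1[of x i] points_level_0_1[of y j] that True pq
          \<open>p \<in> points\<close> \<open>q \<in> points\<close> by simp
      then show ?thesis
        using that points_closed True by (auto simp: pq level_dist.simps)
    next
      case False
      then have "weight i \<noteq> weight j" by simp
      then have "0 < max (weight i) (weight j)"
        using weight_nonneg[of i] weight_nonneg[of j] by linarith
      also have "\<dots> \<le> level_dist p q" using level_dist_ge_max[OF False] pq by simp
      finally show ?thesis using False pq by auto
    qed
  qed
  show "level_dist p r \<le> level_dist p q + level_dist q r" if "p \<in> points" "q \<in> points" "r \<in> points" for p q r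
  proof (cases p; cases q; cases r)
    fix x i y j z k assume pqr: "p = (x, i)" "q = (y, j)" "r = (z, k)"
    then have G: "x \<in> carrier G" "y \<in> carrier G" "z \<in> carrier G"
      using that points_closed by auto
    consider "i = j" | "j = k" | "i \<noteq> j" "j \<noteq> k" by blast
    then show ?thesis
    proof cases
      case 1
      then show ?thesis
        using level_dist_change_point[OF G, of i k] by (simp add: pqr level_dist_same_level)
    next
      case 2
      then show ?thesis
        using level_dist_change_point[OF G(3,2,1), of k i]
        by (simp add: pqr level_dist_same_level level_dist_commute commute)
    next
      case 3
      \<comment> \<open>The two legs through the other level have lengths at least
        \<open>weight i\<close> and \<open>weight k\<close>.\<close>
      have "level_dist p r \<le> weight i + weight k"
        using level_dist_same_level_le[of x i z] level_dist_le_add[of i k x z]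
        using weight_nonneg[of k] by (cases "i = k") (auto simp: pqr intro: order_trans)
      then show ?thesis
        using level_dist_ge_max[OF 3(1), of x y] level_dist_ge_max[OF 3(2), of y z] by (simp add: pqr)
    qed
  qed
qed (auto simp: level_dist_nonneg level_dist_commute)

section \<open>Compactness of the space of levels\<close>

lemma continuous_map_level:
  assumes "2 \<le> n"
  shows "continuous_map T K.mtopology (\<lambda>x. (x, n))"
proof -
  have "level_dist (x, n) (y, n) \<le> d x y" for x y
    using assms mult_right_mono[of "weight n" 1 "d x y"] by (simp add: level_dist.simps weight_def)
  then have "continuous_map mtopology K.mtopology (\<lambda>x. (x, n))"
    unfolding metric_continuous_map[OF K.Metric_space_axioms]
    using assms by (auto simp: points_def) (meson order_le_less_trans)
  then show ?thesis by (simp add: mtopology_eq)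
qed

text \<open>A member of the cover around the limit point swallows all but finitely many levels; the
  rest is a finite union of compact sets.\<close>

lemma compact_points: "compact_space K.mtopology"
  unfolding compact_space
proof (intro allI impI)
  fix \<U> assume \<U>: "(\<forall>U\<in>\<U>. openin K.mtopology U) \<and> \<Union>\<U> = topspace K.mtopology"
  have zero: "(\<one>, 0) \<in> points" by (simp add: points_def)
  then obtain U where U: "U \<in> \<U>" "(\<one>, 0) \<in> U" using \<U> by auto
  then obtain e where e: "0 < e" "K.mball (\<one>, 0) e \<subseteq> U"
    using \<U> by (meson K.openin_mtopology)
  \<comment> \<open>Points on a level \<open>n > N\<close> have distance at most
    \<open>weight n < e\<close> from the limit point.\<close>
  obtain N :: nat where N: "1 / e < N" using reals_Archimedean2 by blast
  define C where "C = {(\<one>, 1)} \<union> (\<Union>n\<in>{2..N}. (\<lambda>x. (x, n)) ` carrier G)"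
  have "compactin T (carrier G)"
    using compact_T topspace_eq_carrier by (simp add: compact_space_def)
  then have "compactin K.mtopology C"
    unfolding C_def
    by (intro compactin_Un compactin_Union)
      (auto intro!: image_compactin[where X = T] continuous_map_level simp: marker_in_points[simplified])
  moreover have "C \<subseteq> points" by (auto simp: C_def points_def)
  then have "C \<subseteq> \<Union>\<U>" using \<U> by simp
  ultimately obtain \<F> where \<F>: "finite \<F>" "\<F> \<subseteq> \<U>" "C \<subseteq> \<Union>\<F>"
    using \<U> unfolding compactin_def by meson
  have "points \<subseteq> U \<union> C"
  proof
    fix p assume p: "p \<in> points"
    obtain x n where xn: "p = (x, n)" by fastforce
    show "p \<in> U \<union> C"
    proof (cases "n = 0 \<or> n \<in> {1..N}")
      case True
      then show ?thesis
        using p U(2) by (auto simp: xn C_def points_def)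
    next
      case False
      then have "N < n" by auto
      then have "1 / e < n" using N by linarith
      then have "weight n < e" using e(1) False by (simp add: weight_def field_simps)
      then have "p \<in> K.mball (\<one>, 0) e"
        using p zero False level_dist_le_add[of 0 n \<one> x] by (auto simp: xn)
      then show ?thesis using e(2) by blast
    qed
  qed
  then have "points \<subseteq> \<Union>(insert U \<F>)" using \<F>(3) by blast
  moreover have "\<Union>(insert U \<F>) \<subseteq> points" using \<U> U(1) \<F>(2) by auto
  ultimately show "\<exists>\<F>. finite \<F> \<and> \<F> \<subseteq> \<U> \<and> \<Union>\<F> = topspace K.mtopology"
    using \<F> U(1) by (intro exI[of _ "insert U \<F>"]) auto
qed

section \<open>The action of the group by left translations\<close>

lemma translate_closed: "translate g p \<in> points" if "g \<in> carrier G" "p \<in> points"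
  using that by (auto simp: points_def)

lemma translate_mult:
  "translate (g \<otimes> h) p = translate g (translate h p)" if "g \<in> carrier G" "h \<in> carrier G" "p \<in> points"
  using that by (auto simp: points_def m_assoc)

text \<open>Left translations preserve \<open>d\<close> and, by associativity, commute with right
  multiplication by \<open>a j\<close>. Distances between levels \<open>0\<close> or
  \<open>1\<close> and a copy of the group depend on the level alone.\<close>

lemma level_dist_translate:
  assumes "g \<in> carrier G" "p \<in> points" "q \<in> points"
  shows "level_dist (translate g p) (translate g q) = level_dist p q"
proof (cases p; cases q)
  fix x i y j assume pq: "p = (x, i)" "q = (y, j)"
  have x: "x \<in> carrier G" and y: "y \<in> carrier G" using assms points_closed by (auto simp: pq)
  have off: "offset i j (g \<otimes> x) (g \<otimes> y) = offset i j x y"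
    if "x \<in> carrier G" "y \<in> carrier G" for i j x y
    using that assms(1) a_closed by (simp add: offset_def m_assoc d_left)
  consider "2 \<le> i" "2 \<le> j" | "i < 2" "j < 2" | "i = 0" "2 \<le> j" | "i = 1" "2 \<le> j" | "2 \<le> i" "j = 0" | "2 \<le> i" "j = 1"
    by linarith
  then show ?thesis
  proof cases
    case 1
    then show ?thesis using off x y assms(1) by (simp add: pq level_dist.simps d_left)
  next
    case 2
    then show ?thesis by (simp add: pq)
  qed (use weight_le[of i] weight_le[of j] weight_nonneg[of i] weight_nonneg[of j] in
       \<open>auto simp: pq level_dist.simps offset_def\<close>)
qed

lemma translate_faithful:
  assumes "g \<in> carrier G" "h \<in> carrier G" "\<And>p. p \<in> points \<Longrightarrow> translate g p = translate h p"
  shows "g = h"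
  using assms(3)[of "(\<one>, 2)"] assms(1,2) by (simp add: points_def)

lemma continuous_map_translate:
  assumes "p \<in> points"
  shows "continuous_map T K.mtopology (\<lambda>g. translate g p)"
proof (cases p)
  case (Pair x n)
  have x: "x \<in> carrier G" using assms points_closed Pair by blast
  show ?thesis
  proof (cases "2 \<le> n")
    case True
    have "continuous_map T T (\<lambda>g. g \<otimes> x)"
      using continuous_map_compose[OF continuous_map_pairedI continuous_mult, of T "\<lambda>g. g" "\<lambda>g. x"]
        x topspace_eq_carrier by (simp add: comp_def)
    from continuous_map_compose[OF this continuous_map_level[OF True]]
    show ?thesis using True Pair by (simp add: comp_def)
  next
    case False
    then show ?thesis using assms Pair by simp
  qed
qed

section \<open>Rigidity of the isometries\<close>

lemma level_dist_marker: "level_dist (\<one>, 1) p = 1 + weight (snd p)" if "p \<in> points" "p \<noteq> (\<one>, 1)"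
  using that weight_le[of "snd p"] by (cases p) (auto simp: level_dist.simps offset_def points_def)

text \<open>Weights away from the marker are at most \<open>1 / 2\<close>, and on different levels
  they cannot both equal it. Since the marker is at distance at least \<open>1\<close> from every
  other point, it is metrically distinguishable.\<close>

lemma level_dist_less_1:
  assumes "p \<in> points" "q \<in> points" "p \<noteq> (\<one>, 1)" "q \<noteq> (\<one>, 1)"
  shows "level_dist p q < 1"
proof (cases p; cases q)
  fix x i y j assume pq: "p = (x, i)" "q = (y, j)"
  have "i \<noteq> 1" "j \<noteq> 1" using assms points_level_0_1 pq by fastforce+
  then have w: "weight i \<le> 1 / 2" "weight j \<le> 1 / 2" using weight_le by auto
  show ?thesis
  proof (cases "i = j")
    case True
    then show ?thesis using w level_dist_same_level_le[of x i y] by (simp add: pq)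
  next
    case False
    then have "weight i \<noteq> weight j" by simp
    then have "weight i + weight j < 1" using w by linarith
    then show ?thesis using level_dist_le_add[OF False, of x y] by (simp add: pq)
  qed
qed

lemma isometry_is_translate:
  assumes "\<psi> \<in> isometries K.Self"
  shows "\<exists>g\<in>carrier G. \<forall>p\<in>points. \<psi> p = translate g p"
proof -
  have bij: "bij_betw \<psi> points points"
    and iso: "\<And>p q. p \<in> points \<Longrightarrow> q \<in> points \<Longrightarrow> level_dist (\<psi> p) (\<psi> q) = level_dist p q"
    using assms by (auto simp: isometries_def Bij_def)
  have cl: "\<psi> p \<in> points" if "p \<in> points" for p using bij that by (rule bij_betw_apply)
  have P: "(\<one>, 1) \<in> points" and Q: "(\<one>, 0) \<in> points" "(\<one>, 2) \<in> points"
    by (auto simp: points_def)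
  have marker: "\<psi> (\<one>, 1) = (\<one>, 1)"
  proof (rule ccontr)
    assume neq: "\<psi> (\<one>, 1) \<noteq> (\<one>, 1)"
    \<comment> \<open>Any third point leads to a contradiction: its preimage \<open>p\<close> is not
      the marker, so \<open>p\<close> is at least \<open>1\<close> from the marker, yet their images
      would be less than \<open>1\<close> apart.\<close>
    obtain q where q: "q \<in> points" "q \<noteq> (\<one>, 1)" "q \<noteq> \<psi> (\<one>, 1)"
    proof (cases "\<psi> (\<one>, 1) = (\<one>, 0)")
      case True
      then show ?thesis using that[OF Q(2)] by simp
    next
      case False
      then show ?thesis using that[OF Q(1)] by simp
    qed
    then obtain p where p: "p \<in> points" "q = \<psi> p" using bij by (metis bij_betw_iff_bijections)
    have "1 \<le> level_dist (\<one>, 1) p" using p q by (subst level_dist_marker) auto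
    also have "\<dots> = level_dist (\<psi> (\<one>, 1)) q" using iso P p by simp
    also have "\<dots> < 1" using level_dist_less_1 cl P q neq by blast
    finally show False by simp
  qed
  have level: "snd (\<psi> p) = snd p" if "p \<in> points" for p
  proof (cases "p = (\<one>, 1)")
    case True
    then show ?thesis using marker by simp
  next
    case False
    then have "\<psi> p \<noteq> (\<one>, 1)" using bij that P marker by (metis bij_betw_iff_bijections)
    then have "1 + weight (snd (\<psi> p)) = 1 + weight (snd p)"
      using iso[OF P that] marker level_dist_marker that cl False by simp
    then show ?thesis by simp
  qed
  define \<phi> where "\<phi> n x = fst (\<psi> (x, n))" for n x
  have \<psi>: "\<psi> (x, n) = (\<phi> n x, n)" and \<phi>: "\<phi> n x \<in> carrier G" if "(x, n) \<in> points" for x n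
    using level[OF that] cl[OF that] points_closed unfolding \<phi>_def by (metis prod.collapse snd_conv)+
  have L: "(x, n) \<in> points" if "x \<in> carrier G" "2 \<le> n" for x n
    using that by (simp add: points_def)
  \<comment> \<open>From \<open>(y, i)\<close> to level \<open>j\<close> the least distance
    \<open>weight i\<close> is attained only at \<open>y \<otimes> a j\<close>, and
    \<open>\<psi>\<close> preserves that relation.\<close>
  have shift: "\<phi> j (x \<otimes> a j) = \<phi> i x \<otimes> a j" if ij: "2 \<le> i" "i < j" and x: "x \<in> carrier G" for i j x
  proof -
    have *: "(x, i) \<in> points" "(x \<otimes> a j, j) \<in> points" using ij x a_closed by (auto intro: L)
    have "level_dist (y, i) (z, j) = weight i + weight j * d (y \<otimes> a j) z" for y z
      using ij weight_mono[of i j] by (simp add: level_dist.simps offset_def)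
    with iso[OF *] have "d (\<phi> i x \<otimes> a j) (\<phi> j (x \<otimes> a j)) = 0"
      using ij x a_closed \<psi>[OF *(1)] \<psi>[OF *(2)] by simp
    then show ?thesis using \<phi>[OF *(1)] \<phi>[OF *(2)] a_closed by simp
  qed
  define h where "h = \<phi> 2"
  have \<phi>_eq: "\<phi> n x = h x" if "2 \<le> n" "x \<in> carrier G" for n x
  proof -
    \<comment> \<open>Level \<open>Suc n\<close> lies beyond both \<open>n\<close> and
      \<open>2\<close>, so both maps can be compared there; then \<open>a (Suc n)\<close>
      cancels.\<close>
    have "\<phi> n x \<otimes> a (Suc n) = \<phi> 2 x \<otimes> a (Suc n)"
      using shift[of n "Suc n" x] shift[of 2 "Suc n" x] that by simp
    then show ?thesis using \<phi>[OF L] that a_closed by (simp add: h_def)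
  qed
  have h: "h x \<in> carrier G" if "x \<in> carrier G" for x
    using \<phi>[OF L] that by (simp add: h_def)
  have h_iso: "d (h x) (h y) = d x y" if "x \<in> carrier G" "y \<in> carrier G" for x y
    using iso[OF L L, of x 2 y 2] that \<psi>[OF L] by (simp add: h_def level_dist.simps weight_2)
  \<comment> \<open>The restriction \<open>2 < j\<close> comes from comparing level \<open>2\<close>
    with a later one; \<open>a_dense\<close> is stated to match.\<close>
  have h_shift: "h (a j) = h \<one> \<otimes> a j" if "2 < j" for j
    using shift[of 2 j \<one>] \<phi>_eq[of j "a j"] that a_closed by (simp add: h_def)
  \<comment> \<open>Both sides preserve distances in \<open>y\<close> and agree on the dense set of
    the \<open>a j\<close> with \<open>2 < j\<close>.\<close>
  have h_eq: "h y = h \<one> \<otimes> y" if y: "y \<in> carrier G" for y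
  proof -
    have "d (h y) (h \<one> \<otimes> y) \<le> 0"
    proof (rule field_le_epsilon)
      fix e :: real assume "0 < e"
      then obtain j where j: "2 < j" "d (a j) y < e / 2" using a_dense[OF y, of "e / 2"] by auto
      have "d (h y) (h \<one> \<otimes> y) \<le> d (h y) (h (a j)) + d (h (a j)) (h \<one> \<otimes> y)"
        using h y a_closed by (intro triangle) auto
      also have "\<dots> = d y (a j) + d (a j) y"
        using h_iso[OF y a_closed, of j] d_left[OF h[OF one_closed] a_closed y] 
        by (simp add: h_shift[OF j(1)])
      also have "\<dots> \<le> 0 + e" using j(2) commute[of y "a j"] by simp
      finally show "d (h y) (h \<one> \<otimes> y) \<le> 0 + e" .
    qed
    then have "d (h y) (h \<one> \<otimes> y) = 0" using nonneg by (rule antisym)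
    then show ?thesis using h y by simp
  qed
  have "\<psi> p = translate (h \<one>) p" if "p \<in> points" for p
  proof (cases p)
    case (Pair x n)
    show ?thesis
    proof (cases "2 \<le> n")
      case True
      then show ?thesis
        using \<psi>[of x n] \<phi>_eq[of n x] h_eq[of x] that points_closed Pair by simp
    next
      case False
      moreover from this have "\<phi> n x = \<one>" "x = \<one>"
        using points_level_0_1[of "\<phi> n x" n] points_level_0_1[of x n] cl[OF that] \<psi>[of x n] that Pair
        by auto
      ultimately show ?thesis using \<psi>[of x n] that Pair by simp
    qed
  qed
  then show ?thesis using h by blast
qed

end

section \<open>Transfer to a space of real sequences\<close>

context marked_group
begin

text \<open>Conjugating by \<open>\<phi>\<close> carries the action on \<open>points\<close> to any
  isometric copy, whatever its type.\<close>

lemma isometric_copy_realizes_group: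
  assumes bij: "bij_betw \<phi> points (mspace K')"
    and iso: "\<And>p q. p \<in> points \<Longrightarrow> q \<in> points \<Longrightarrow> mdist K' (\<phi> p) (\<phi> q) = level_dist p q"
  shows "topological_group_isomorphic G T (Iso_group K') (Iso_topology K')"
proof -
  let ?M' = "mspace K'"
  define \<sigma> where "\<sigma> = inv_into points \<phi>"
  have \<phi>: "\<phi> p \<in> ?M'" and \<sigma>_\<phi>: "\<sigma> (\<phi> p) = p" if "p \<in> points" for p
    using bij that by (auto simp: \<sigma>_def bij_betw_apply bij_betw_inv_into_left)
  have \<sigma>: "\<sigma> u \<in> points" and \<phi>_\<sigma>: "\<phi> (\<sigma> u) = u" if "u \<in> ?M'" for u
    using bij that
    by (auto simp: \<sigma>_def bij_betw_inv_into_right intro: bij_betw_apply[OF bij_betw_inv_into])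
  have iso': "level_dist (\<sigma> u) (\<sigma> v) = mdist K' u v" if "u \<in> ?M'" "v \<in> ?M'" for u v
    using iso[OF \<sigma> \<sigma>] \<phi>_\<sigma> that by simp
  have cont: "continuous_map K.mtopology (mtopology_of K') \<phi>"
    unfolding mtopology_of_def K.metric_continuous_map[OF Metric_space_mspace_mdist]
    using \<phi> iso by auto
  show ?thesis
  proof (rule topological_group_isomorphic_IsoI[where act = "\<lambda>g u. \<phi> (translate g (\<sigma> u))"])
    show "topological_group G T" by (rule topological_group_axioms)
    show "compact_space T" by (rule compact_T)
    fix g assume g: "g \<in> carrier G"
    show "\<phi> (translate g (\<sigma> u)) \<in> ?M'" if "u \<in> ?M'" for u
      using g that \<phi> \<sigma> translate_closed by blast
    show "mdist K' (\<phi> (translate g (\<sigma> u))) (\<phi> (translate g (\<sigma> v))) = mdist K' u v"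
      if "u \<in> ?M'" "v \<in> ?M'" for u v
      using g that by (simp add: iso iso' \<sigma> translate_closed level_dist_translate)
    fix h assume h: "h \<in> carrier G"
    show "\<phi> (translate (g \<otimes> h) (\<sigma> u)) = \<phi> (translate g (\<sigma> (\<phi> (translate h (\<sigma> u)))))"
      if "u \<in> ?M'" for u
      using g h that by (simp add: \<sigma> \<sigma>_\<phi> translate_closed translate_mult)
    show "g = h" if eq: "\<And>u. u \<in> ?M' \<Longrightarrow> \<phi> (translate g (\<sigma> u)) = \<phi> (translate h (\<sigma> u))"
    proof (rule translate_faithful[OF g h])
      fix p assume p: "p \<in> points"
      then have "\<sigma> (\<phi> (translate g p)) = \<sigma> (\<phi> (translate h p))"
        using eq[OF \<phi>[OF p]] by (simp add: \<sigma>_\<phi>)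
      then show "translate g p = translate h p"
        using g h p by (simp add: \<sigma>_\<phi> translate_closed)
    qed
  next
    fix u assume "u \<in> ?M'"
    from continuous_map_compose[OF continuous_map_translate[OF \<sigma>[OF this]] cont]
    show "continuous_map T (mtopology_of K') (\<lambda>g. \<phi> (translate g (\<sigma> u)))"
      by (simp add: comp_def)
  next
    fix \<psi> assume \<psi>: "\<psi> \<in> isometries K'"
    then have bij_\<psi>: "bij_betw \<psi> ?M' ?M'"
      and iso_\<psi>: "\<And>u v. u \<in> ?M' \<Longrightarrow> v \<in> ?M' \<Longrightarrow> mdist K' (\<psi> u) (\<psi> v) = mdist K' u v"
      by (auto simp: isometries_def Bij_def)
    have \<psi>_closed: "\<psi> u \<in> ?M'" if "u \<in> ?M'" for u using bij_\<psi> that by (rule bij_betw_apply)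
    \<comment> \<open>An isometry of the copy is pulled back to \<open>points\<close>, where it must
      be a translation; the restriction makes it extensional.\<close>
    define \<theta> where "\<theta> = restrict (\<sigma> \<circ> \<psi> \<circ> \<phi>) points"
    have "bij_betw (\<sigma> \<circ> \<psi> \<circ> \<phi>) points points"
      using bij bij_\<psi> unfolding \<sigma>_def by (intro bij_betw_trans[OF bij] bij_betw_trans[OF bij_\<psi>] bij_betw_inv_into)
    then have "\<theta> \<in> isometries K.Self"
      using iso iso' iso_\<psi> \<phi> \<psi>_closed
      by (simp add: \<theta>_def isometries_def Bij_def bij_betw_restrict_eq)
    then obtain g where g: "g \<in> carrier G" "\<forall>p\<in>points. \<theta> p = translate g p"
      using isometry_is_translate by blast
    have "\<psi> u = \<phi> (translate g (\<sigma> u))" if "u \<in> ?M'" for u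
    proof -
      have "translate g (\<sigma> u) = \<sigma> (\<psi> u)"
        using bspec[OF g(2) \<sigma>[OF that]] that by (simp add: \<theta>_def \<sigma> \<phi>_\<sigma>)
      then show ?thesis using \<phi>_\<sigma> \<psi>_closed that by simp
    qed
    then show "\<exists>g\<in>carrier G. \<forall>u\<in>?M'. \<psi> u = \<phi> (translate g (\<sigma> u))" using g(1) by blast
  qed
qed

end

lemma (in topological_group) ex_marked_group:
  assumes "compact_space T" "metrizable_space T"
  obtains d a where "marked_group G T d a"
proof -
  obtain d where d: "Metric_space (carrier G) d" "Metric_space.mtopology (carrier G) d = T"
    "\<And>x y. d x y \<le> 1"
    "\<And>g x y. g \<in> carrier G \<Longrightarrow> x \<in> carrier G \<Longrightarrow> y \<in> carrier G \<Longrightarrow> d (g \<otimes> x) (g \<otimes> y) = d x y"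
    "\<And>g x y. g \<in> carrier G \<Longrightarrow> x \<in> carrier G \<Longrightarrow> y \<in> carrier G \<Longrightarrow> d (x \<otimes> g) (y \<otimes> g) = d x y"
    using ex_bi_invariant_metric[OF assms] by blast
  interpret D: Metric_space "carrier G" d by fact
  obtain b :: "nat \<Rightarrow> 'a" where b: "range b \<subseteq> carrier G"
    "\<And>x e. x \<in> carrier G \<Longrightarrow> 0 < e \<Longrightarrow> \<exists>n. d (b n) x < e"
    using D.compact_imp_dense_sequence assms(1) d(2) carrier_not_empty by metis
  \<comment> \<open>Shifting the sequence by three moves all its entries to indices above
    \<open>2\<close>.\<close>
  have "\<exists>n>2. d (b (n - 3)) x < e" if xe: "x \<in> carrier G" "0 < e" for x e
  proof -
    obtain n where "d (b n) x < e" using b(2)[OF xe] by blast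
    then show ?thesis by (intro exI[of _ "n + 3"]) simp
  qed
  then have "marked_group G T d (\<lambda>n. b (n - 3))"
    using d b(1) assms(1) topological_group_axioms
    by (intro marked_group.intro marked_group_axioms.intro) auto
  then show thesis by (rule that)
qed

theorem theorem2:
  fixes G :: "('a, 'b) monoid_scheme" and T :: "'a topology"
  assumes "topological_group G T"
    and "compact_space T"
    and "metrizable_space T"
  shows "\<exists>K :: (nat \<Rightarrow> real) metric.
    compact_space (mtopology_of K) \<and>
    topological_group_isomorphic G T (Iso_group K) (Iso_topology K)"
proof -
  obtain d a where "marked_group G T d a"
    using topological_group.ex_marked_group[OF assms] .
  then interpret marked_group G T d a .
  have "compact_space (mtopology_of K.Self)"
    using compact_points by (simp add: mtopology_of_def)
  from compact_metric_on_sequences[OF this] obtain K' :: "(nat \<Rightarrow> real) metric" and \<phi>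
    where "bij_betw \<phi> points (mspace K')"
      and "\<forall>p\<in>points. \<forall>q\<in>points. mdist K' (\<phi> p) (\<phi> q) = level_dist p q"
      and "compact_space (mtopology_of K')"
    by auto
  then show ?thesis
    using isometric_copy_realizes_group by blast
qed

end
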